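(* For $w\in(0,1)$ let $x(\cdot,w)\in\mathcal{X}$ be an optimal curve of the weighted-sum scalarization $$\min_{x\in\mathcal{X}}\ \bigl(w\,F_1(x)+(1-w)\,F_2(x)\bigr)$$ of (MOP), with $x(t,w)$ depending smoothly on $(t,w)$, so that $x=x(\cdot,w)$ satisfies the Euler--Lagrange equation $$\nabla_t^3\dot x+R(\nabla_t\dot x,\dot x)\dot x-\tau\nabla_t\dot x=0,\qquad \tau=\frac{w}{1-w}.$$ Suppose that the Pareto front generated with respect to this scalarization can be written as $F_2(w)=PF(F_1(w))$. Then $PF$ is convex if and only if $$\int_{t_0}^{t_f}\langle\nabla_t\dot x(t,w),\,x'(t,w)\rangle\,dt\ \geq\ 0\quad\text{for all } w\in(0,1),$$ where $x'$ denotes the derivative of $x(t,w)$ with respect to the weight $w$.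
   Context: Let $M$ be a path-connected Riemannian manifold with metric $\langle\cdot,\cdot\rangle$, Levi-Civita connection $\nabla$ and Riemannian curvature tensor $R(X,Y)Z=\nabla_X\nabla_YZ-\nabla_Y\nabla_XZ-\nabla_{[X,Y]}Z$; $\nabla_t$ denotes covariant differentiation along a curve with respect to $t$, and a dot denotes $d/dt$. Fix $t_0<t_f$, points $x_0,x_1\in M$ and velocities $v_0\in T_{x_0}M$, $v_1\in T_{x_1}M$. Let $\mathcal{X}$ be the space of all smooth curves $x:[t_0,t_f]\to M$ with $x(t_0)=x_0$, $\dot x(t_0)=v_0$, $x(t_f)=x_1$, $\dot x(t_f)=v_1$. For $x\in\mathcal{X}$ put $$F_1(x)=\int_{t_0}^{t_f}\langle\dot x,\dot x\rangle\,dt,\qquad F_2(x)=\int_{t_0}^{t_f}\langle\nabla_t\dot x,\nabla_t\dot x\rangle\,dt .$$ The problem (MOP) is to minimize the vector $(F_1(x),F_2(x))$ over $x\in\mathcal{X}$. Write $F_i(w):=F_i(x(\cdot,w))$, $i=1,2$. The Pareto front generated with respect to the weighted-sum scalarization is the set of points $(F_1(w),F_2(w))$, $w\in(0,1)$, in the objective value plane; when it is the graph of a function, this function is also denoted $PF$, defined on the set of values of $F_1(w)$. Convexity: $PF$ is called convex if $PF(sF_1+(1-s)\tilde F_1)\le s\,PF(F_1)+(1-s)\,PF(\tilde F_1)$ for all values $F_1,\tilde F_1$ on the front (i.e. in the domain of $PF$) and all $s\in[0,1]$ such that $sF_1+(1-s)\tilde F_1$ is also on the front. *)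

theory Defs
  imports "HOL-Analysis.Analysis"
begin

section \<open>Smooth maps between normed spaces\<close>

text \<open>
  Derivatives are taken within \<open>S\<close>, so that sets such as a closed interval (or its product with an
  open interval) are covered, with one-sided derivatives at the boundary. The notion is only used for
  relatively open subsets of convex sets with nonempty interior, where the derivative within \<open>S\<close>
  is unique.
\<close>

fun differentiable_times_on ::
  "nat \<Rightarrow> 'a::real_normed_vector set \<Rightarrow> ('a \<Rightarrow> 'b::real_normed_vector) \<Rightarrow> bool" where
  "differentiable_times_on 0 S f \<longleftrightarrow> continuous_on S f"
| "differentiable_times_on (Suc k) S f \<longleftrightarrow>
     (\<forall>x\<in>S. f differentiable (at x within S)) \<and>
     (\<forall>v. differentiable_times_on k S (\<lambda>x. frechet_derivative f (at x within S) v))"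

definition smooth_on :: "'a::real_normed_vector set \<Rightarrow> ('a \<Rightarrow> 'b::real_normed_vector) \<Rightarrow> bool" where
  "smooth_on S f \<longleftrightarrow> (\<forall>k. differentiable_times_on k S f)"

section \<open>Smooth manifolds\<close>

text \<open>A chart is a pair of a domain and a coordinate map; the map is only relevant on the domain.\<close>

type_synonym ('a, 'n) chart = "'a set \<times> ('a \<Rightarrow> real ^ 'n)"

definition transition :: "('a, 'n) chart \<Rightarrow> ('a, 'n::finite) chart \<Rightarrow> real ^ 'n \<Rightarrow> real ^ 'n" where
  "transition \<phi> \<psi> = snd \<psi> \<circ> inv_into (fst \<phi>) (snd \<phi>)"

text \<open>
  \<open>M\<close> carries the subspace topology; that it is Hausdorff and second countable is guaranteed by the
  type class of the ambient type.
\<close>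

definition smooth_manifold ::
  "'a::{t2_space, second_countable_topology} set \<Rightarrow> ('a, 'n::finite) chart set \<Rightarrow> bool" where
  "smooth_manifold M A \<longleftrightarrow>
     M = (\<Union>\<phi>\<in>A. fst \<phi>) \<and>
     (\<forall>\<phi>\<in>A. openin (top_of_set M) (fst \<phi>) \<and> open (snd \<phi> ` fst \<phi>) \<and>
        (\<exists>\<phi>'. homeomorphism (fst \<phi>) (snd \<phi> ` fst \<phi>) (snd \<phi>) \<phi>')) \<and>
     (\<forall>\<phi>\<in>A. \<forall>\<psi>\<in>A. smooth_on (snd \<phi> ` (fst \<phi> \<inter> fst \<psi>)) (transition \<phi> \<psi>))"

definition smooth_map_into ::
  "'a::topological_space set \<Rightarrow> ('a, 'n::finite) chart set \<Rightarrow> 'b::real_normed_vector set \<Rightarrow> ('b \<Rightarrow> 'a) \<Rightarrow> bool"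
where
  "smooth_map_into M A S f \<longleftrightarrow>
     continuous_on S f \<and> f ` S \<subseteq> M \<and>
     (\<forall>\<phi>\<in>A. smooth_on {s \<in> S. f s \<in> fst \<phi>} (snd \<phi> \<circ> f))"

section \<open>Tangent vectors\<close>

text \<open>
  A tangent vector at \<open>p\<close> is the family of its coordinate vectors in all charts around \<open>p\<close>, related by
  the Jacobians of the transition maps; entries for all other charts are normalised to \<open>0\<close>.
\<close>

type_synonym ('a, 'n) tangent = "('a, 'n) chart \<Rightarrow> real ^ 'n"

definition charts_at :: "('a, 'n::finite) chart set \<Rightarrow> 'a \<Rightarrow> ('a, 'n) chart set" where
  "charts_at A p = {\<phi> \<in> A. p \<in> fst \<phi>}"

definition tangent_space :: "('a, 'n::finite) chart set \<Rightarrow> 'a \<Rightarrow> ('a, 'n) tangent set" where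
  "tangent_space A p =
     {v. (\<forall>\<phi>\<in>charts_at A p. \<forall>\<psi>\<in>charts_at A p.
            v \<psi> = frechet_derivative (transition \<phi> \<psi>) (at (snd \<phi> p)) (v \<phi>)) \<and>
         (\<forall>\<phi>. \<phi> \<notin> charts_at A p \<longrightarrow> v \<phi> = 0)}"

definition velocity ::
  "('a, 'n::finite) chart set \<Rightarrow> real set \<Rightarrow> (real \<Rightarrow> 'a) \<Rightarrow> real \<Rightarrow> ('a, 'n) tangent" where
  "velocity A I c t = (\<lambda>\<phi>. if \<phi> \<in> charts_at A (c t)
                           then vector_derivative (snd \<phi> \<circ> c) (at t within I) else 0)"

section \<open>Riemannian metric, Levi-Civita connection, curvature\<close>

text \<open>A metric is given by its Gram matrices in the charts, as functions of the coordinates.\<close>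

type_synonym ('a, 'n) metric = "('a, 'n) chart \<Rightarrow> real ^ 'n \<Rightarrow> real ^ 'n ^ 'n"

definition riemannian_metric :: "('a, 'n::finite) chart set \<Rightarrow> ('a, 'n) metric \<Rightarrow> bool" where
  "riemannian_metric A g \<longleftrightarrow>
     (\<forall>\<phi>\<in>A. smooth_on (snd \<phi> ` fst \<phi>) (g \<phi>) \<and>
        (\<forall>y\<in>snd \<phi> ` fst \<phi>. transpose (g \<phi> y) = g \<phi> y \<and> (\<forall>u. u \<noteq> 0 \<longrightarrow> 0 < u \<bullet> (g \<phi> y *v u)))) \<and>
     (\<forall>\<phi>\<in>A. \<forall>\<psi>\<in>A. \<forall>p\<in>fst \<phi> \<inter> fst \<psi>. \<forall>u v.
        let J = frechet_derivative (transition \<phi> \<psi>) (at (snd \<phi> p)) in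
        u \<bullet> (g \<phi> (snd \<phi> p) *v v) = J u \<bullet> (g \<psi> (snd \<psi> p) *v J v))"

text \<open>The value does not depend on the choice of the chart when \<open>u\<close> and \<open>v\<close> are tangent vectors at \<open>p\<close>.\<close>

definition inner_at ::
  "('a, 'n::finite) chart set \<Rightarrow> ('a, 'n) metric \<Rightarrow> 'a \<Rightarrow> ('a, 'n) tangent \<Rightarrow> ('a, 'n) tangent \<Rightarrow> real" where
  "inner_at A g p u v =
     (let \<phi> = (SOME \<phi>. \<phi> \<in> charts_at A p) in u \<phi> \<bullet> (g \<phi> (snd \<phi> p) *v v \<phi>))"

text \<open>
  In the next definitions \<open>G\<close> is the Gram matrix in one chart, and vector fields on the chart are given
  by their coordinate functions. \<open>christoffel_symbol G y k i j\<close> is \<open>\<Gamma>\<close> with upper index \<open>k\<close>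
  and lower indices \<open>i, j\<close>.
\<close>

definition partial_deriv :: "'n \<Rightarrow> (real ^ 'n::finite \<Rightarrow> real) \<Rightarrow> real ^ 'n \<Rightarrow> real" where
  "partial_deriv i f y = frechet_derivative f (at y) (axis i 1)"

definition christoffel_symbol ::
  "(real ^ 'n \<Rightarrow> real ^ 'n ^ 'n) \<Rightarrow> real ^ 'n::finite \<Rightarrow> 'n \<Rightarrow> 'n \<Rightarrow> 'n \<Rightarrow> real" where
  "christoffel_symbol G y k i j =
     (\<Sum>l\<in>UNIV. matrix_inv (G y) $ k $ l *
        (partial_deriv i (\<lambda>z. G z $ j $ l) y + partial_deriv j (\<lambda>z. G z $ i $ l) y
          - partial_deriv l (\<lambda>z. G z $ i $ j) y)) / 2"

definition christoffel ::
  "(real ^ 'n \<Rightarrow> real ^ 'n ^ 'n) \<Rightarrow> real ^ 'n::finite \<Rightarrow> real ^ 'n \<Rightarrow> real ^ 'n \<Rightarrow> real ^ 'n" where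
  "christoffel G y u v =
     (\<chi> k. \<Sum>i\<in>UNIV. \<Sum>j\<in>UNIV. christoffel_symbol G y k i j * u $ i * v $ j)"

text \<open>The Christoffel symbols are those of the torsion-free connection compatible with \<open>G\<close>.\<close>

lemma partial_deriv_metric_commute:
  fixes G :: "real ^ 'n \<Rightarrow> real ^ 'n ^ 'n"
  assumes S: "open S" "y \<in> S" "\<And>z. z \<in> S \<Longrightarrow> transpose (G z) = G z"
    and diff: "G differentiable (at y)"
  shows "partial_deriv l (\<lambda>z. G z $ i $ j) y = partial_deriv l (\<lambda>z. G z $ j $ i) y"
proof -
  have sym: "G z $ i $ j = G z $ j $ i" if "z \<in> S" for z i j
    using arg_cong[OF S(3)[OF that], of "\<lambda>B. B $ j $ i"] by (simp add: transpose_def)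
  have bl: "bounded_linear (\<lambda>B :: real ^ 'n ^ 'n. B $ i $ j)"
    by (intro bounded_linear_compose[OF bounded_linear_vec_nth] bounded_linear_vec_nth)
  then have d: "(\<lambda>z. G z $ i $ j) differentiable (at y)"
    using bounded_linear.has_derivative[OF bl] diff unfolding differentiable_def by blast
  show ?thesis
    unfolding partial_deriv_def
    using frechet_derivative_transform_within_open[OF d S(1,2), of "\<lambda>z. G z $ j $ i"] sym by simp
qed

lemma christoffel_symbol_commute:
  assumes "open S" "y \<in> S" "\<And>z. z \<in> S \<Longrightarrow> transpose (G z) = G z" "G differentiable (at y)"
  shows "christoffel_symbol G y k i j = christoffel_symbol G y k j i"
  unfolding christoffel_symbol_def
  by (simp add: algebra_simps partial_deriv_metric_commute[OF assms, of _ i j])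

lemma christoffel_symbol_lowered:
  assumes "invertible (G y)"
  shows "(\<Sum>k\<in>UNIV. G y $ m $ k * christoffel_symbol G y k i j) =
    (partial_deriv i (\<lambda>z. G z $ j $ m) y + partial_deriv j (\<lambda>z. G z $ i $ m) y
          - partial_deriv m (\<lambda>z. G z $ i $ j) y) / 2"
proof -
  define T where "T = (\<lambda>l. (partial_deriv i (\<lambda>z. G z $ j $ l) y + partial_deriv j (\<lambda>z. G z $ i $ l) y
          - partial_deriv l (\<lambda>z. G z $ i $ j) y))"
  have inv: "G y ** matrix_inv (G y) = mat 1"
    using assms unfolding invertible_def matrix_inv_def by (rule someI2_ex) simp
  have "(\<chi> k. christoffel_symbol G y k i j) = matrix_inv (G y) *v (\<chi> l. T l / 2)"
    by (simp add: christoffel_symbol_def T_def matrix_vector_mult_def vec_eq_iff sum_divide_distrib)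
  then have "G y *v (\<chi> k. christoffel_symbol G y k i j) = (\<chi> l. T l / 2)"
    by (simp add: matrix_vector_mul_assoc inv)
  then show ?thesis
    by (simp add: vec_eq_iff matrix_vector_mult_def T_def)
qed

lemma christoffel_symbol_metric:
  assumes S: "open S" "y \<in> S" "\<And>z. z \<in> S \<Longrightarrow> transpose (G z) = G z" "G differentiable (at y)"
    and inv: "invertible (G y)"
  shows "partial_deriv m (\<lambda>z. G z $ i $ j) y =
    (\<Sum>k\<in>UNIV. G y $ j $ k * christoffel_symbol G y k m i) +
    (\<Sum>k\<in>UNIV. G y $ i $ k * christoffel_symbol G y k m j)"
  unfolding christoffel_symbol_lowered[where G = G and y = y, OF inv]
  by (simp add: partial_deriv_metric_commute[OF S, of m j i] flip: add_divide_distrib)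

definition levi_civita ::
  "(real ^ 'n \<Rightarrow> real ^ 'n ^ 'n) \<Rightarrow> (real ^ 'n \<Rightarrow> real ^ 'n) \<Rightarrow> (real ^ 'n \<Rightarrow> real ^ 'n) \<Rightarrow>
    real ^ 'n::finite \<Rightarrow> real ^ 'n" where
  "levi_civita G X Y y = frechet_derivative Y (at y) (X y) + christoffel G y (X y) (Y y)"

definition lie_bracket ::
  "(real ^ 'n \<Rightarrow> real ^ 'n) \<Rightarrow> (real ^ 'n \<Rightarrow> real ^ 'n) \<Rightarrow> real ^ 'n::finite \<Rightarrow> real ^ 'n" where
  "lie_bracket X Y y = frechet_derivative Y (at y) (X y) - frechet_derivative X (at y) (Y y)"

definition curvature_field ::
  "(real ^ 'n \<Rightarrow> real ^ 'n ^ 'n) \<Rightarrow> (real ^ 'n \<Rightarrow> real ^ 'n) \<Rightarrow> (real ^ 'n \<Rightarrow> real ^ 'n) \<Rightarrow>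
    (real ^ 'n \<Rightarrow> real ^ 'n) \<Rightarrow> real ^ 'n::finite \<Rightarrow> real ^ 'n" where
  "curvature_field G X Y Z y =
     levi_civita G X (levi_civita G Y Z) y - levi_civita G Y (levi_civita G X Z) y
       - levi_civita G (lie_bracket X Y) Z y"

text \<open>
  The curvature is tensorial, so on tangent vectors it can be evaluated by extending them to fields
  that are constant in the coordinates.
\<close>

definition curvature ::
  "('a, 'n::finite) chart set \<Rightarrow> ('a, 'n) metric \<Rightarrow> 'a \<Rightarrow>
    ('a, 'n) tangent \<Rightarrow> ('a, 'n) tangent \<Rightarrow> ('a, 'n) tangent \<Rightarrow> ('a, 'n) tangent" where
  "curvature A g p u v w = (\<lambda>\<phi>. if \<phi> \<in> charts_at A p
     then curvature_field (g \<phi>) (\<lambda>_. u \<phi>) (\<lambda>_. v \<phi>) (\<lambda>_. w \<phi>) (snd \<phi> p) else 0)"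

text \<open>Covariant derivative along the curve \<open>c\<close> of a vector field \<open>V\<close> along \<open>c\<close>.\<close>

definition covariant_deriv ::
  "('a, 'n::finite) chart set \<Rightarrow> ('a, 'n) metric \<Rightarrow> real set \<Rightarrow> (real \<Rightarrow> 'a) \<Rightarrow>
    (real \<Rightarrow> ('a, 'n) tangent) \<Rightarrow> real \<Rightarrow> ('a, 'n) tangent" where
  "covariant_deriv A g I c V t = (\<lambda>\<phi>. if \<phi> \<in> charts_at A (c t)
     then vector_derivative (\<lambda>s. V s \<phi>) (at t within I)
            + christoffel (g \<phi>) (snd \<phi> (c t)) (velocity A I c t \<phi>) (V t \<phi>)
     else 0)"

section \<open>The optimization problem\<close>

definition admissible_curves ::
  "'a::topological_space set \<Rightarrow> ('a, 'n::finite) chart set \<Rightarrow> real \<Rightarrow> real \<Rightarrow>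
    'a \<Rightarrow> ('a, 'n) tangent \<Rightarrow> 'a \<Rightarrow> ('a, 'n) tangent \<Rightarrow> (real \<Rightarrow> 'a) set" where
  "admissible_curves M A t0 tf x0 v0 x1 v1 =
     {c. smooth_map_into M A {t0..tf} c \<and>
         c t0 = x0 \<and> velocity A {t0..tf} c t0 = v0 \<and>
         c tf = x1 \<and> velocity A {t0..tf} c tf = v1}"

definition acceleration ::
  "('a, 'n::finite) chart set \<Rightarrow> ('a, 'n) metric \<Rightarrow> real set \<Rightarrow> (real \<Rightarrow> 'a) \<Rightarrow> real \<Rightarrow> ('a, 'n) tangent" where
  "acceleration A g I c = covariant_deriv A g I c (velocity A I c)"

definition F1 ::
  "('a, 'n::finite) chart set \<Rightarrow> ('a, 'n) metric \<Rightarrow> real \<Rightarrow> real \<Rightarrow> (real \<Rightarrow> 'a) \<Rightarrow> real" where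
  "F1 A g t0 tf c = integral {t0..tf}
     (\<lambda>t. inner_at A g (c t) (velocity A {t0..tf} c t) (velocity A {t0..tf} c t))"

definition F2 ::
  "('a, 'n::finite) chart set \<Rightarrow> ('a, 'n) metric \<Rightarrow> real \<Rightarrow> real \<Rightarrow> (real \<Rightarrow> 'a) \<Rightarrow> real" where
  "F2 A g t0 tf c = integral {t0..tf}
     (\<lambda>t. inner_at A g (c t) (acceleration A g {t0..tf} c t) (acceleration A g {t0..tf} c t))"

definition euler_lagrange ::
  "('a, 'n::finite) chart set \<Rightarrow> ('a, 'n) metric \<Rightarrow> real set \<Rightarrow> real \<Rightarrow> (real \<Rightarrow> 'a) \<Rightarrow> bool" where
  "euler_lagrange A g I \<tau> c \<longleftrightarrow>
     (\<forall>t\<in>I. \<forall>\<phi>\<in>charts_at A (c t).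
        (covariant_deriv A g I c ^^ 3) (velocity A I c) t \<phi>
        + curvature A g (c t) (acceleration A g I c t) (velocity A I c t) (velocity A I c t) \<phi>
        - \<tau> *\<^sub>R acceleration A g I c t \<phi> = 0)"

definition convex_front :: "real set \<Rightarrow> (real \<Rightarrow> real) \<Rightarrow> bool" where
  "convex_front D PF \<longleftrightarrow>
     (\<forall>a\<in>D. \<forall>b\<in>D. \<forall>s\<in>{0..1}. s * a + (1 - s) * b \<in> D \<longrightarrow>
        PF (s * a + (1 - s) * b) \<le> s * PF a + (1 - s) * PF b)"

end

theory Submission
  imports Defs
begin

text \<open>
  Both sides of the equivalence hold. Optimality of the curve for weight \<open>w\<close> says that the line of
  slope \<open>- w / (1 - w)\<close> through its point on the front supports the front, so \<open>PF\<close> is convex.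
  Adding the optimality inequalities for two weights shows that \<open>F1\<close> is non-increasing in \<open>w\<close>,
  while the first variation formula, whose boundary terms vanish since the endpoints are fixed,
  reads \<open>F1' = - 2 \<integral> \<langle>\<nabla>\<^sub>t v, x'\<rangle> dt\<close>, where \<open>v\<close> is the velocity;
  hence the integral is nonnegative.
\<close>

section \<open>Smooth maps and mixed partial derivatives\<close>

text \<open>\<open>F2\<close> enters only through its values in the optimality inequalities and is
  never differentiated, so the calculus concerns \<open>F1\<close> alone. It rests on the pointwise
  identity <\<open>\<nabla>\<^sub>t v\<close>, x'> = d/dt <v, x'> - 1/2 d/dw <v, v>, which combines
  compatibility of the connection with the metric and symmetry of the mixed derivatives in t and w.
  The obstacle is the encoding. A tangent vector is a family over all charts, and
  \<open>inner_at\<close> evaluates in a chart chosen separately at each point, so regularity of an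
  inner product along the family of curves cannot be read off its definition. Each scalar is
  therefore rewritten in one fixed chart on a relatively open piece of the strip [t0, tf] x (0, 1).
  This strip is closed in time, hence all derivatives are taken within it.\<close>

lemma at_within_openin:
  assumes "openin (top_of_set S) W" "s \<in> W"
  shows "at s within W = at s within S"
proof -
  obtain T where "open T" "W = S \<inter> T"
    using assms(1) by (auto simp: openin_open)
  then show ?thesis
    using assms(2) by (intro at_within_nhd[of s T]) auto
qed

text \<open>The total derivative restricts to a slice; \<open>b \<in> J\<close> keeps the slice
  inside the product. One-sided derivatives at the ends of \<open>I\<close> are covered.\<close>

lemma has_vector_derivative_fst:
  assumes "(h has_derivative D) (at (a, b) within I \<times> J)" "b \<in> J"
  shows "((\<lambda>t. h (t, b)) has_vector_derivative D (1, 0)) (at a within I)"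
proof -
  have "(h has_derivative D) (at ((\<lambda>t. (t, b)) a) within (\<lambda>t. (t, b)) ` I)"
    using assms by (auto intro: has_derivative_subset)
  moreover have "((\<lambda>t. (t, b)) has_derivative (\<lambda>k. (k, 0))) (at a within I)"
    by (auto intro!: derivative_eq_intros)
  ultimately have "((\<lambda>t. h (t, b)) has_derivative (\<lambda>k. D (k, 0))) (at a within I)"
    using has_derivative_in_compose[of "\<lambda>t. (t, b)" "\<lambda>k. (k, 0)" a I h D] by blast
  moreover have "D (k, 0) = k *\<^sub>R D (1, 0)" for k
    using linear_scale[OF has_derivative_linear[OF assms(1)], of k "(1, 0)"] by simp
  ultimately show ?thesis
    unfolding has_vector_derivative_def by (metis (lifting) ext has_derivative_eq_rhs)
qed

lemma has_vector_derivative_snd: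
  assumes "(h has_derivative D) (at (a, b) within I \<times> J)" "a \<in> I"
  shows "((\<lambda>w. h (a, w)) has_vector_derivative D (0, 1)) (at b within J)"
proof -
  have "(h has_derivative D) (at ((\<lambda>t. (a, t)) b) within (\<lambda>t. (a, t)) ` J)"
    using assms by (auto intro: has_derivative_subset)
  moreover have "((\<lambda>t. (a, t)) has_derivative (\<lambda>k. (0, k))) (at b within J)"
    by (auto intro!: derivative_eq_intros)
  ultimately have "((\<lambda>t. h (a, t)) has_derivative (\<lambda>k. D (0, k))) (at b within J)"
    using has_derivative_in_compose[of "\<lambda>t. (a, t)" "\<lambda>k. (0, k)" b J h D] by blast
  moreover have "D (0, k) = k *\<^sub>R D (0, 1)" for k
    using linear_scale[OF has_derivative_linear[OF assms(1)], of k "(0, 1)"] by simp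
  ultimately show ?thesis
    unfolding has_vector_derivative_def by (metis (lifting) ext has_derivative_eq_rhs)
qed

text \<open>Symmetry comes from differentiating under the integral sign. Continuity is asked of one
  mixed partial near the point, and the other one has to exist at the point only.\<close>

lemma mixed_partial_derivatives_commute:
  fixes f p q r u :: "real \<times> real \<Rightarrow> 'b::banach"
  assumes Q: "open Q" "(a, b) \<in> Q"
    and p: "\<And>t w. (t, w) \<in> Q \<Longrightarrow> ((\<lambda>t. f (t, w)) has_vector_derivative p (t, w)) (at t)"
    and q: "\<And>t w. (t, w) \<in> Q \<Longrightarrow> ((\<lambda>w. f (t, w)) has_vector_derivative q (t, w)) (at w)"
    and r: "\<And>t w. (t, w) \<in> Q \<Longrightarrow> ((\<lambda>w. p (t, w)) has_vector_derivative r (t, w)) (at w)"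
    and u: "((\<lambda>t. q (t, b)) has_vector_derivative u (a, b)) (at a)"
    and cont: "continuous_on Q r"
  shows "r (a, b) = u (a, b)"
proof -
  obtain Q1 Q2 where Q12: "open Q1" "open Q2" "a \<in> Q1" "b \<in> Q2" "Q1 \<times> Q2 \<subseteq> Q"
    using Q by (elim open_prod_elim) auto
  obtain d1 where d1: "d1 > 0" "cball a d1 \<subseteq> Q1"
    using Q12 open_contains_cball by blast
  obtain d2 where d2: "d2 > 0" "cball b d2 \<subseteq> Q2"
    using Q12 open_contains_cball by blast
  define a0 a1 b0 b1 where "a0 = a - d1" "a1 = a + d1" "b0 = b - d2" "b1 = b + d2"
  have ab: "a0 < a" "a < a1" "b0 < b" "b < b1"
    using d1 d2 by (auto simp: a0_a1_b0_b1_def)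
  have sub: "{a0..a1} \<times> {b0..b1} \<subseteq> Q"
    using d1 d2 Q12 by (auto simp: a0_a1_b0_b1_def cball_eq_atLeastAtMost)
  have ftc: "((\<lambda>\<tau>. p (\<tau>, w)) has_integral (f (t, w) - f (a0, w))) {a0..t}"
    if "t \<in> {a0..a1}" "w \<in> {b0..b1}" for t w
    using that sub
    by (intro fundamental_theorem_of_calculus has_vector_derivative_at_within[OF p]) auto
  \<comment> \<open>This is the derivative at \<open>w = b\<close> of f(t, w) = f(a0, w) + integral
    of p; differentiating the result in t at \<open>a\<close> then gives the claim.\<close>
  have int: "q (t, b) = q (a0, b) + integral {a0..t} (\<lambda>\<tau>. r (\<tau>, b))" if t: "t \<in> {a0..a1}" for t
  proof -
    have "((\<lambda>w. integral (cbox a0 t) (\<lambda>\<tau>. p (\<tau>, w))) has_vector_derivative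
        integral (cbox a0 t) (\<lambda>\<tau>. r (\<tau>, b))) (at b within {b0..b1})"
    proof (rule leibniz_rule_vector_derivative)
      show "((\<lambda>x. p (\<tau>, x)) has_vector_derivative r (\<tau>, w)) (at w within {b0..b1})"
        if "w \<in> {b0..b1}" "\<tau> \<in> cbox a0 t" for w \<tau>
        using that t sub by (intro has_vector_derivative_at_within[OF r]) auto
      show "(\<lambda>\<tau>. p (\<tau>, w)) integrable_on cbox a0 t" if "w \<in> {b0..b1}" for w
        using ftc[OF t that] by auto
      show "continuous_on ({b0..b1} \<times> cbox a0 t) (\<lambda>(x, t). r (t, x))"
        unfolding split_beta using t sub
        by (intro continuous_on_compose2[OF cont] continuous_intros) auto
    qed (use ab in auto)
    then have "((\<lambda>w. f (a0, w) + integral {a0..t} (\<lambda>\<tau>. p (\<tau>, w))) has_vector_derivative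
        q (a0, b) + integral {a0..t} (\<lambda>\<tau>. r (\<tau>, b))) (at b within {b0..b1})"
      using ab sub
      by (intro has_vector_derivative_add has_vector_derivative_at_within[OF q]) auto
    then have "((\<lambda>w. f (t, w)) has_vector_derivative
        q (a0, b) + integral {a0..t} (\<lambda>\<tau>. r (\<tau>, b))) (at b within {b0..b1})"
      by (rule has_vector_derivative_transform[rotated -1])
         (use ab ftc[OF t, THEN integral_unique] in auto)
    then have "((\<lambda>w. f (t, w)) has_vector_derivative
        q (a0, b) + integral {a0..t} (\<lambda>\<tau>. r (\<tau>, b))) (at b)"
      using ab by (simp add: at_within_Icc_at)
    moreover have "((\<lambda>w. f (t, w)) has_vector_derivative q (t, b)) (at b)"
      using t ab sub by (intro q) auto
    ultimately show ?thesis
      using vector_derivative_unique_at by metis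
  qed
  have "((\<lambda>t. integral {a0..t} (\<lambda>\<tau>. r (\<tau>, b))) has_vector_derivative r (a, b))
      (at a within {a0..a1})"
    using ab sub
    by (intro integral_has_vector_derivative continuous_on_compose2[OF cont] continuous_intros) auto
  then have "((\<lambda>t. q (a0, b) + integral {a0..t} (\<lambda>\<tau>. r (\<tau>, b))) has_vector_derivative r (a, b))
      (at a within {a0..a1})"
    by (auto intro!: derivative_eq_intros)
  then have "((\<lambda>t. q (t, b)) has_vector_derivative r (a, b)) (at a within {a0..a1})"
    by (rule has_vector_derivative_transform[rotated -1]) (use ab in \<open>auto intro: int\<close>)
  then have "((\<lambda>t. q (t, b)) has_vector_derivative r (a, b)) (at a)"
    using ab by (simp add: at_within_Icc_at)
  then show ?thesis
    using u vector_derivative_unique_at by metis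
qed

section \<open>Continuity and derivatives of smooth maps\<close>

lemma smooth_on_imp_continuous_on: "smooth_on S f \<Longrightarrow> continuous_on S f"
  unfolding smooth_on_def using differentiable_times_on.simps(1) by blast

lemma smooth_on_has_derivative:
  assumes "smooth_on S f" "x \<in> S"
  shows "(f has_derivative frechet_derivative f (at x within S)) (at x within S)"
proof -
  have "differentiable_times_on (Suc 0) S f"
    using assms(1) by (simp only: smooth_on_def)
  then have "f differentiable (at x within S)"
    using assms(2) by simp
  then show ?thesis
    by (simp only: frechet_derivative_works)
qed

lemma smooth_on_frechet_derivative:
  assumes "smooth_on S f"
  shows "smooth_on S (\<lambda>x. frechet_derivative f (at x within S) v)"
  unfolding smooth_on_def
proof
  fix k
  have "differentiable_times_on (Suc k) S f"
    using assms by (simp only: smooth_on_def)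
  then show "differentiable_times_on k S (\<lambda>x. frechet_derivative f (at x within S) v)"
    by simp
qed

text \<open>Smoothness gives continuity of the derivative in each fixed direction. A moving
  direction \<open>u s\<close> is reduced to this by expanding it in the finite basis.\<close>

lemma continuous_on_frechet_derivative_compose:
  fixes G :: "'a::euclidean_space \<Rightarrow> 'b::real_normed_vector"
  assumes G: "smooth_on S G" "open S"
    and y: "continuous_on W y" "y ` W \<subseteq> S" and u: "continuous_on W u"
  shows "continuous_on W (\<lambda>s. frechet_derivative G (at (y s)) (u s))"
proof -
  have eq: "frechet_derivative G (at (y s)) (u s) =
      (\<Sum>e\<in>Basis. (u s \<bullet> e) *\<^sub>R frechet_derivative G (at (y s) within S) e)" if "s \<in> W" for s
  proof -
    have at: "at (y s) within S = at (y s)"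
      using that y(2) G(2) by (intro at_within_open) auto
    have lin: "linear (frechet_derivative G (at (y s)))"
      using has_derivative_linear[OF smooth_on_has_derivative[OF G(1), of "y s"]] that y(2) at by auto
    show ?thesis
      unfolding at
      by (subst euclidean_representation[of "u s", symmetric])
         (simp only: linear_sum[OF lin] linear_scale[OF lin])
  qed
  have "continuous_on W (\<lambda>s. frechet_derivative G (at (y s) within S) e)" for e
    using smooth_on_imp_continuous_on[OF smooth_on_frechet_derivative[OF G(1)]] y
    by (rule continuous_on_compose2)
  then have "continuous_on W (\<lambda>s. \<Sum>e\<in>Basis. (u s \<bullet> e) *\<^sub>R frechet_derivative G (at (y s) within S) e)"
    using u by (intro continuous_intros)
  then show ?thesis
    by (rule continuous_on_eq) (simp add: eq)
qed

lemma bounded_bilinear_matrix_vector_mult: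
  "bounded_bilinear ((*v) :: real ^ 'n ^ 'm \<Rightarrow> real ^ 'n \<Rightarrow> real ^ 'm)"
proof -
  have "bilinear ((*v) :: real ^ 'n ^ 'm \<Rightarrow> real ^ 'n \<Rightarrow> real ^ 'm)"
    unfolding bilinear_def
    by (intro conjI allI linearI)
       (simp_all add: matrix_vector_mult_add_rdistrib matrix_vector_right_distrib
          matrix_vector_mult_scaleR flip: scaleR_matrix_vector_assoc)
  then show ?thesis
    by (simp add: bilinear_conv_bounded_bilinear)
qed

section \<open>Tangent vectors and the metric in charts\<close>

text \<open>Pairing with \<open>G y *v v\<close> lowers the upper index, so the inverse matrix
  disappears. Because both lower slots carry the same vector \<open>u\<close>, the first two
  derivative terms coincide and their halves add up, while the third one keeps its factor
  1/2.\<close>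

lemma inner_christoffel:
  fixes G :: "real ^ 'n \<Rightarrow> real ^ 'n ^ 'n"
  assumes S: "open S" "y \<in> S" "\<And>z. z \<in> S \<Longrightarrow> transpose (G z) = G z" "G differentiable (at y)"
    and inv: "invertible (G y)"
  shows "christoffel G y u u \<bullet> (G y *v v) =
    u \<bullet> (frechet_derivative G (at y) u *v v) - u \<bullet> (frechet_derivative G (at y) v *v u) / 2"
proof -
  define D where "D = frechet_derivative G (at y)"
  have D: "(G has_derivative D) (at y)"
    using S(4) by (simp add: D_def frechet_derivative_works)
  have lin: "linear D"
    using D by (rule has_derivative_linear)
  have pd: "partial_deriv i (\<lambda>z. G z $ j $ k) y = D (axis i 1) $ j $ k" for i j k
  proof -
    have "((\<lambda>z. G z $ j $ k) has_derivative (\<lambda>h. D h $ j $ k)) (at y)"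
      by (intro bounded_linear.has_derivative[OF bounded_linear_vec_nth] D)
    then show ?thesis
      unfolding partial_deriv_def using frechet_derivative_at by metis
  qed
  have Dsum: "D h $ j $ k = (\<Sum>i\<in>UNIV. h $ i * partial_deriv i (\<lambda>z. G z $ j $ k) y)" for h j k
  proof -
    have "D h = D (\<Sum>i\<in>UNIV. h $ i *\<^sub>R axis i 1)"
      by (simp add: basis_expansion flip: scalar_mult_eq_scaleR)
    then show ?thesis
      by (simp add: linear_sum[OF lin] linear_scale[OF lin] pd)
  qed
  define d where "d = (\<lambda>i j k. partial_deriv i (\<lambda>z. G z $ j $ k) y)"
  have sym: "G y $ k $ m = G y $ m $ k" for k m
    using S(3)[OF S(2)] by (metis transpose_def vec_lambda_beta)
  have "christoffel G y u u \<bullet> (G y *v v) =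
      (\<Sum>k\<in>UNIV. \<Sum>m\<in>UNIV. \<Sum>i\<in>UNIV. \<Sum>j\<in>UNIV.
         G y $ m $ k * christoffel_symbol G y k i j * (u $ i * u $ j * v $ m))"
  proof -
    have "christoffel G y u u $ k * (G y *v v) $ k = (\<Sum>m\<in>UNIV. \<Sum>i\<in>UNIV. \<Sum>j\<in>UNIV.
        G y $ m $ k * christoffel_symbol G y k i j * (u $ i * u $ j * v $ m))" for k
      unfolding christoffel_def matrix_vector_mult_def vec_lambda_beta
      unfolding sum_distrib_left
      unfolding sum_distrib_right
      by (intro sum.cong refl) (simp add: sym mult_ac)
    then show ?thesis
      by (simp add: inner_vec_def)
  qed
  \<comment> \<open>The index \<open>k\<close> has to be innermost for
    \<open>christoffel_symbol_lowered\<close> to apply. Below, \<open>d i j k\<close> is the i-th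
    partial derivative of the Gram entry with indices j, k.\<close>
  also have "\<dots> = (\<Sum>m\<in>UNIV. \<Sum>i\<in>UNIV. \<Sum>j\<in>UNIV. \<Sum>k\<in>UNIV.
         G y $ m $ k * christoffel_symbol G y k i j * (u $ i * u $ j * v $ m))"
    by (subst sum.swap, rule sum.cong[OF refl], subst sum.swap, rule sum.cong[OF refl], rule sum.swap)
  also have "\<dots> = (\<Sum>m\<in>UNIV. \<Sum>i\<in>UNIV. \<Sum>j\<in>UNIV.
         (d i j m + d j i m - d m i j) / 2 * (u $ i * u $ j * v $ m))"
    unfolding sum_distrib_right[symmetric]
    by (simp only: christoffel_symbol_lowered[where G = G and y = y, OF inv] d_def)
  also have "\<dots> = (\<Sum>m\<in>UNIV. \<Sum>i\<in>UNIV. \<Sum>j\<in>UNIV. d i j m * (u $ i * u $ j * v $ m)) / 2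
      + (\<Sum>m\<in>UNIV. \<Sum>i\<in>UNIV. \<Sum>j\<in>UNIV. d j i m * (u $ i * u $ j * v $ m)) / 2
      - (\<Sum>m\<in>UNIV. \<Sum>i\<in>UNIV. \<Sum>j\<in>UNIV. d m i j * (u $ i * u $ j * v $ m)) / 2"
    by (simp add: sum_divide_distrib algebra_simps add_divide_distrib diff_divide_distrib
        flip: sum.distrib sum_subtractf)
  also have "(\<Sum>m\<in>UNIV. \<Sum>i\<in>UNIV. \<Sum>j\<in>UNIV. d i j m * (u $ i * u $ j * v $ m)) =
      u \<bullet> (D u *v v)"
  proof -
    have "u \<bullet> (D u *v v) = (\<Sum>j\<in>UNIV. \<Sum>m\<in>UNIV. \<Sum>i\<in>UNIV. d i j m * (u $ i * u $ j * v $ m))"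
      by (simp add: inner_vec_def matrix_vector_mult_def Dsum d_def sum_distrib_left
          sum_distrib_right mult_ac)
    also have "\<dots> = (\<Sum>m\<in>UNIV. \<Sum>i\<in>UNIV. \<Sum>j\<in>UNIV. d i j m * (u $ i * u $ j * v $ m))"
      by (subst sum.swap, rule sum.cong[OF refl], rule sum.swap)
    finally show ?thesis ..
  qed
  also have "(\<Sum>m\<in>UNIV. \<Sum>i\<in>UNIV. \<Sum>j\<in>UNIV. d j i m * (u $ i * u $ j * v $ m)) =
      u \<bullet> (D u *v v)"
  proof -
    have "u \<bullet> (D u *v v) = (\<Sum>i\<in>UNIV. \<Sum>m\<in>UNIV. \<Sum>j\<in>UNIV. d j i m * (u $ i * u $ j * v $ m))"
      by (simp add: inner_vec_def matrix_vector_mult_def Dsum d_def sum_distrib_left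
          sum_distrib_right mult_ac)
    also have "\<dots> = (\<Sum>m\<in>UNIV. \<Sum>i\<in>UNIV. \<Sum>j\<in>UNIV. d j i m * (u $ i * u $ j * v $ m))"
      by (rule sum.swap)
    finally show ?thesis ..
  qed
  also have "(\<Sum>m\<in>UNIV. \<Sum>i\<in>UNIV. \<Sum>j\<in>UNIV. d m i j * (u $ i * u $ j * v $ m)) =
      u \<bullet> (D v *v u)"
  proof -
    have "u \<bullet> (D v *v u) = (\<Sum>i\<in>UNIV. \<Sum>j\<in>UNIV. \<Sum>m\<in>UNIV. d m i j * (u $ i * u $ j * v $ m))"
      by (simp add: inner_vec_def matrix_vector_mult_def Dsum d_def sum_distrib_left
          sum_distrib_right mult_ac)
    also have "\<dots> = (\<Sum>i\<in>UNIV. \<Sum>m\<in>UNIV. \<Sum>j\<in>UNIV. d m i j * (u $ i * u $ j * v $ m))"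
      by (rule sum.cong[OF refl], rule sum.swap)
    also have "\<dots> = (\<Sum>m\<in>UNIV. \<Sum>i\<in>UNIV. \<Sum>j\<in>UNIV. d m i j * (u $ i * u $ j * v $ m))"
      by (rule sum.swap)
    finally show ?thesis ..
  qed
  finally show ?thesis
    by (simp add: D_def)
qed

lemma invertible_pos_def:
  fixes B :: "real ^ 'n ^ 'n"
  assumes "\<And>u. u \<noteq> 0 \<Longrightarrow> 0 < u \<bullet> (B *v u)"
  shows "invertible B"
proof -
  have "u = 0" if "B *v u = 0" for u
    using assms[of u] that by force
  then show ?thesis
    unfolding invertible_left_inverse matrix_left_invertible_ker by blast
qed

text \<open>Openness is known for the image of a whole chart domain; the homeomorphism carries it
  over to the overlap. It turns the derivative of a transition map within the overlap into the
  derivative \<open>at\<close> the point that \<open>tangent_space\<close> uses.\<close>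

lemma transition_domain_open:
  assumes "smooth_manifold M A" "\<phi> \<in> A" "\<psi> \<in> A"
  shows "open (snd \<phi> ` (fst \<phi> \<inter> fst \<psi>))"
proof -
  obtain \<phi>' where h: "homeomorphism (fst \<phi>) (snd \<phi> ` fst \<phi>) (snd \<phi>) \<phi>'"
    and o: "open (snd \<phi> ` fst \<phi>)"
    using assms unfolding smooth_manifold_def by blast
  have "openin (top_of_set M) (fst \<psi>)" and sub: "fst \<phi> \<subseteq> M"
    using assms unfolding smooth_manifold_def by blast+
  then obtain T where "open T" "fst \<psi> = M \<inter> T"
    by (auto simp: openin_open)
  then have "openin (top_of_set (fst \<phi>)) (fst \<phi> \<inter> fst \<psi>)"
    using sub by (auto simp: openin_open)
  from homeomorphism_imp_open_map[OF h this] show ?thesis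
    using o openin_open_trans by blast
qed

lemma chart_inv_into:
  assumes "smooth_manifold M A" "\<phi> \<in> A" "p \<in> fst \<phi>"
  shows "inv_into (fst \<phi>) (snd \<phi>) (snd \<phi> p) = p"
proof -
  obtain \<phi>' where "homeomorphism (fst \<phi>) (snd \<phi> ` fst \<phi>) (snd \<phi>) \<phi>'"
    using assms unfolding smooth_manifold_def by blast
  then have "inj_on (snd \<phi>) (fst \<phi>)"
    by (metis homeomorphism_apply1 inj_on_inverseI)
  then show ?thesis
    using assms(3) by (rule inv_into_f_f)
qed

text \<open>The transformation law is the chain rule through the transition map. A general
  \<open>I\<close> serves both the closed time interval and the open weight interval; nontriviality
  of the filter makes the derivative within \<open>I\<close> unique.\<close>

lemma velocity_in_tangent_space:
  assumes M: "smooth_manifold M A"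
    and t: "t \<in> I" "at t within I \<noteq> bot"
    and c: "continuous_on I c" "c ` I \<subseteq> M"
    and diff: "\<And>\<phi>. \<phi> \<in> charts_at A (c t) \<Longrightarrow> (snd \<phi> \<circ> c) differentiable (at t within I)"
  shows "velocity A I c t \<in> tangent_space A (c t)"
proof -
  have transform: "velocity A I c t \<psi> =
      frechet_derivative (transition \<phi> \<psi>) (at (snd \<phi> (c t))) (velocity A I c t \<phi>)"
    if "\<phi> \<in> charts_at A (c t)" "\<psi> \<in> charts_at A (c t)" for \<phi> \<psi>
  proof -
    have \<phi>\<psi>: "\<phi> \<in> A" "\<psi> \<in> A" "c t \<in> fst \<phi>" "c t \<in> fst \<psi>"
      using that by (auto simp: charts_at_def)
    let ?D = "snd \<phi> ` (fst \<phi> \<inter> fst \<psi>)"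
    let ?J = "frechet_derivative (transition \<phi> \<psi>) (at (snd \<phi> (c t)))"
    have "smooth_on ?D (transition \<phi> \<psi>)"
      using M \<phi>\<psi> unfolding smooth_manifold_def by blast
    then have J: "(transition \<phi> \<psi> has_derivative ?J) (at (snd \<phi> (c t)))"
      using smooth_on_has_derivative[of ?D "transition \<phi> \<psi>" "snd \<phi> (c t)"] \<phi>\<psi>
        at_within_open[OF _ transition_domain_open[OF M \<phi>\<psi>(1,2)], of "snd \<phi> (c t)"] by auto
    let ?v = "vector_derivative (snd \<phi> \<circ> c) (at t within I)"
    have v: "((snd \<phi> \<circ> c) has_vector_derivative ?v) (at t within I)"
      using diff[OF that(1)] by (simp add: vector_derivative_works)
    have "((transition \<phi> \<psi> \<circ> (snd \<phi> \<circ> c)) has_vector_derivative ?J ?v) (at t within I)"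
        by (rule vector_derivative_diff_chain_within[OF v])
         (simp add: has_derivative_at_withinI[OF J])
    \<comment> \<open>The coordinate representations are related only while the curve stays in both
      charts, which continuity guarantees near \<open>t\<close>.\<close>
    moreover have "\<forall>\<^sub>F s in at t within I. (transition \<phi> \<psi> \<circ> (snd \<phi> \<circ> c)) s = (snd \<psi> \<circ> c) s"
    proof -
      have "openin (top_of_set M) (fst \<phi>)" "openin (top_of_set M) (fst \<psi>)"
        using M \<phi>\<psi> unfolding smooth_manifold_def by blast+
      then have "openin (top_of_set M) (fst \<phi> \<inter> fst \<psi>)"
        by (rule openin_Int)
      then obtain T where T: "open T" "fst \<phi> \<inter> fst \<psi> = M \<inter> T"
        by (auto simp: openin_open)
      have "(c \<longlongrightarrow> c t) (at t within I)"
        using c(1) t(1) by (simp add: continuous_on)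
      then have "\<forall>\<^sub>F s in at t within I. c s \<in> T"
        using T \<phi>\<psi> by (intro topological_tendstoD) auto
      moreover have "\<forall>\<^sub>F s in at t within I. s \<in> I"
        by (simp add: eventually_at_filter)
      ultimately show ?thesis
      proof eventually_elim
        case (elim s)
        then have "c s \<in> fst \<phi>"
          using T c(2) by blast
        then show ?case
          using chart_inv_into[OF M \<phi>\<psi>(1)] by (simp add: transition_def)
      qed
    qed
    ultimately have "((snd \<psi> \<circ> c) has_vector_derivative ?J ?v) (at t within I)"
      unfolding has_vector_derivative_def
      using t(1) chart_inv_into[OF M \<phi>\<psi>(1,3)]
      by (elim has_derivative_transform_eventually) (simp_all add: transition_def)
    then have "vector_derivative (snd \<psi> \<circ> c) (at t within I) = ?J ?v"
      using t(2) by (intro vector_derivative_within)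
    then show ?thesis
      using that by (simp add: velocity_def)
  qed
  have "velocity A I c t \<phi> = 0" if "\<phi> \<notin> charts_at A (c t)" for \<phi>
    using that by (simp add: velocity_def)
  with transform show ?thesis
    unfolding tangent_space_def by blast
qed

text \<open>The chart chosen inside \<open>inner_at\<close> may jump from point to point. Invariance
  of the metric under transition maps allows any chart around the point instead, so a single one can
  be kept on a neighbourhood.\<close>

lemma inner_at_eq_chart:
  assumes metric: "riemannian_metric A g"
    and uv: "u \<in> tangent_space A p" "v \<in> tangent_space A p" and \<psi>: "\<psi> \<in> charts_at A p"
  shows "inner_at A g p u v = u \<psi> \<bullet> (g \<psi> (snd \<psi> p) *v v \<psi>)"
proof -
  define \<phi> where "\<phi> = (SOME \<phi>. \<phi> \<in> charts_at A p)"
  have \<phi>: "\<phi> \<in> charts_at A p"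
    unfolding \<phi>_def using \<psi> by (rule someI)
  let ?J = "frechet_derivative (transition \<phi> \<psi>) (at (snd \<phi> p))"
  have J: "u \<psi> = ?J (u \<phi>)" "v \<psi> = ?J (v \<phi>)"
    using uv \<phi> \<psi> unfolding tangent_space_def by blast+
  have \<phi>\<psi>: "\<phi> \<in> A" "\<psi> \<in> A" "p \<in> fst \<phi> \<inter> fst \<psi>"
    using \<phi> \<psi> by (auto simp: charts_at_def)
  have "u \<phi> \<bullet> (g \<phi> (snd \<phi> p) *v v \<phi>) = ?J (u \<phi>) \<bullet> (g \<psi> (snd \<psi> p) *v ?J (v \<phi>))"
    using metric[unfolded riemannian_metric_def Let_def, THEN conjunct2, rule_format, OF \<phi>\<psi>] .
  then show ?thesis
    by (simp add: inner_at_def J flip: \<phi>_def)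
qed

lemma Gram_matrix_has_derivative:
  assumes "smooth_manifold M A" "riemannian_metric A g" "\<phi> \<in> A" "z \<in> snd \<phi> ` fst \<phi>"
  shows "(g \<phi> has_derivative frechet_derivative (g \<phi>) (at z)) (at z)"
proof -
  have "open (snd \<phi> ` fst \<phi>)"
    using assms unfolding smooth_manifold_def by blast
  moreover have "smooth_on (snd \<phi> ` fst \<phi>) (g \<phi>)"
    using assms unfolding riemannian_metric_def by blast
  ultimately show ?thesis
    using smooth_on_has_derivative[of "snd \<phi> ` fst \<phi>" "g \<phi>" z] assms(4) at_within_open[OF assms(4)]
    by simp
qed

section \<open>First variation of the energy\<close>

locale variation =
  fixes M :: "'a::{t2_space, second_countable_topology} set"
    and A :: "('a, 'n::finite) chart set"
    and g :: "('a, 'n) metric"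
    and t0 tf :: real
    and f :: "real \<times> real \<Rightarrow> 'a"
  assumes manifold: "smooth_manifold M A"
    and metric: "riemannian_metric A g"
    and interval: "t0 < tf"
    and smooth: "smooth_map_into M A ({t0..tf} \<times> {0<..<1}) f"
begin

section \<open>The family of curves in coordinates\<close>

definition S :: "(real \<times> real) set" where
  "S = {t0..tf} \<times> {0<..<1}"

definition W :: "('a, 'n) chart \<Rightarrow> (real \<times> real) set" where
  "W \<phi> = {s \<in> S. f s \<in> fst \<phi>}"

definition y :: "('a, 'n) chart \<Rightarrow> real \<times> real \<Rightarrow> real ^ 'n" where
  "y \<phi> = snd \<phi> \<circ> f"

text \<open>The argument \<open>a\<close> is a direction in the parameter strip:
  \<open>(1, 0)\<close> is time and \<open>(0, 1)\<close> is the weight. The derivative is within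
  \<open>W \<phi>\<close>, where the coordinates are meaningful; by \<open>at_W\<close> this filter
  agrees with the one within \<open>S\<close>.\<close>

definition dy :: "real \<times> real \<Rightarrow> ('a, 'n) chart \<Rightarrow> real \<times> real \<Rightarrow> real ^ 'n" where
  "dy a \<phi> s = frechet_derivative (y \<phi>) (at s within W \<phi>) a"

definition ddy :: "real \<times> real \<Rightarrow> ('a, 'n) chart \<Rightarrow> real \<times> real \<Rightarrow> real \<times> real \<Rightarrow> real ^ 'n" where
  "ddy a \<phi> s h = frechet_derivative (dy a \<phi>) (at s within W \<phi>) h"

lemma continuous_on_f: "continuous_on S f" and f_into: "f ` S \<subseteq> M"
  and smooth_y: "\<phi> \<in> A \<Longrightarrow> smooth_on (W \<phi>) (y \<phi>)"
  using smooth unfolding smooth_map_into_def S_def W_def y_def by blast+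

lemma openin_W: "\<phi> \<in> A \<Longrightarrow> openin (top_of_set S) (W \<phi>)"
proof -
  assume "\<phi> \<in> A"
  then have "openin (top_of_set M) (fst \<phi>)"
    using manifold unfolding smooth_manifold_def by blast
  then have "openin (top_of_set S) (S \<inter> f -` fst \<phi>)"
    using continuous_on_f f_into by (intro continuous_openin_preimage) auto
  moreover have "S \<inter> f -` fst \<phi> = W \<phi>"
    by (auto simp: W_def)
  ultimately show ?thesis
    by simp
qed

lemma at_W: "\<phi> \<in> A \<Longrightarrow> s \<in> W \<phi> \<Longrightarrow> at s within W \<phi> = at s within S"
  by (rule at_within_openin[OF openin_W])

lemma smooth_dy: "\<phi> \<in> A \<Longrightarrow> smooth_on (W \<phi>) (dy a \<phi>)"
  unfolding dy_def by (intro smooth_on_frechet_derivative smooth_y)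

lemma has_derivative_y:
  assumes "\<phi> \<in> A" "s \<in> W \<phi>"
  shows "(y \<phi> has_derivative (\<lambda>h. dy h \<phi> s)) (at s within S)"
  using smooth_on_has_derivative[OF smooth_y[OF assms(1)] assms(2)] by (simp add: dy_def at_W[OF assms])

lemma has_derivative_dy:
  assumes "\<phi> \<in> A" "s \<in> W \<phi>"
  shows "(dy a \<phi> has_derivative ddy a \<phi> s) (at s within S)"
proof -
  have "ddy a \<phi> s = frechet_derivative (dy a \<phi>) (at s within W \<phi>)"
    by (simp add: ddy_def fun_eq_iff)
  then show ?thesis
    using smooth_on_has_derivative[OF smooth_dy[OF assms(1)] assms(2), of a]
    by (simp add: at_W[OF assms])
qed

lemma continuous_on_y: "\<phi> \<in> A \<Longrightarrow> continuous_on (W \<phi>) (y \<phi>)"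
  and continuous_on_dy: "\<phi> \<in> A \<Longrightarrow> continuous_on (W \<phi>) (dy a \<phi>)"
  and continuous_on_ddy: "\<phi> \<in> A \<Longrightarrow> continuous_on (W \<phi>) (\<lambda>s. ddy a \<phi> s h)"
  unfolding ddy_def
  by (intro smooth_on_imp_continuous_on smooth_on_frechet_derivative smooth_y smooth_dy; assumption)+

lemma charts_at_f: "s \<in> S \<Longrightarrow> \<phi> \<in> charts_at A (f s) \<longleftrightarrow> \<phi> \<in> A \<and> s \<in> W \<phi>"
  by (auto simp: charts_at_def W_def)

lemma chart_at_f_exists:
  assumes "s \<in> S" shows "\<exists>\<phi>. \<phi> \<in> charts_at A (f s)"
proof -
  have "f s \<in> (\<Union>\<phi>\<in>A. fst \<phi>)"
    using f_into manifold assms unfolding smooth_manifold_def by blast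
  then show ?thesis
    by (auto simp: charts_at_def)
qed

lemma at_weight: "w \<in> {0<..<1} \<Longrightarrow> at w within {0<..<1} = at (w :: real)"
  by (rule at_within_open[OF _ open_greaterThanLessThan])

lemma weight_interval_nontrivial: "w \<in> {0<..<1} \<Longrightarrow> at w within {0<..<(1::real)} \<noteq> bot"
  by (simp add: at_weight)

definition time_velocity :: "real \<times> real \<Rightarrow> ('a, 'n) tangent" where
  "time_velocity s = velocity A {t0..tf} (\<lambda>t. f (t, snd s)) (fst s)"

text \<open>This is the field x' of the theorem, as a function on the whole parameter strip.\<close>

definition variation_field :: "real \<times> real \<Rightarrow> ('a, 'n) tangent" where
  "variation_field s = velocity A {0<..<1} (\<lambda>w. f (fst s, w)) (snd s)"

lemma y_has_time_derivative:
  assumes "\<phi> \<in> A" "(t, w) \<in> W \<phi>"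
  shows "((\<lambda>t. y \<phi> (t, w)) has_vector_derivative dy (1, 0) \<phi> (t, w)) (at t within {t0..tf})"
  using has_derivative_y[OF assms] assms(2) unfolding S_def
  by (intro has_vector_derivative_fst) (auto simp: W_def S_def)

lemma y_has_variation_derivative:
  assumes "\<phi> \<in> A" "(t, w) \<in> W \<phi>"
  shows "((\<lambda>w. y \<phi> (t, w)) has_vector_derivative dy (0, 1) \<phi> (t, w)) (at w within {0<..<1})"
  using has_derivative_y[OF assms] assms(2) unfolding S_def
  by (intro has_vector_derivative_snd) (auto simp: W_def S_def)

lemma time_interval_nontrivial: "t \<in> {t0..tf} \<Longrightarrow> at t within {t0..tf} \<noteq> bot"
  using interval trivial_limit_within[of t "{t0..tf}"] by simp

lemma time_velocity_chart:
  assumes "\<phi> \<in> A" "s \<in> W \<phi>"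
  shows "time_velocity s \<phi> = dy (1, 0) \<phi> s"
proof -
  obtain t w where s: "s = (t, w)" by force
  have "s \<in> S" "\<phi> \<in> charts_at A (f s)"
    using assms by (auto simp: W_def charts_at_def)
  then show ?thesis
    using vector_derivative_within[OF time_interval_nontrivial y_has_time_derivative, of t \<phi> w] assms
    by (simp add: time_velocity_def velocity_def s S_def y_def comp_def)
qed

lemma variation_field_chart:
  assumes "\<phi> \<in> A" "s \<in> W \<phi>"
  shows "variation_field s \<phi> = dy (0, 1) \<phi> s"
proof -
  obtain t w where s: "s = (t, w)" by force
  have "s \<in> S" "\<phi> \<in> charts_at A (f s)"
    using assms by (auto simp: W_def charts_at_def)
  then show ?thesis
    using assms
      vector_derivative_within[OF weight_interval_nontrivial y_has_variation_derivative, of w \<phi> t]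
    by (simp add: variation_field_def velocity_def s S_def y_def comp_def)
qed

lemma time_velocity_tangent:
  assumes "s \<in> S" shows "time_velocity s \<in> tangent_space A (f s)"
proof -
  obtain t w where s: "s = (t, w)" by force
  have tw: "t \<in> {t0..tf}" "w \<in> {0<..<1}"
    using assms by (auto simp: S_def s)
  have "velocity A {t0..tf} (\<lambda>t. f (t, w)) t \<in> tangent_space A (f (t, w))"
  proof (rule velocity_in_tangent_space[OF manifold])
    show "continuous_on {t0..tf} (\<lambda>t. f (t, w))"
      using tw by (intro continuous_on_compose2[OF continuous_on_f] continuous_intros) (auto simp: S_def)
    show "(\<lambda>t. f (t, w)) ` {t0..tf} \<subseteq> M"
      using f_into tw by (auto simp: S_def)
    show "(snd \<phi> \<circ> (\<lambda>t. f (t, w))) differentiable (at t within {t0..tf})"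
      if "\<phi> \<in> charts_at A (f (t, w))" for \<phi>
      using that y_has_time_derivative[of \<phi> t w] assms
      by (auto simp: charts_at_f s y_def comp_def has_vector_derivative_def differentiable_def)
  qed (use tw time_interval_nontrivial in auto)
  then show ?thesis
    by (simp add: time_velocity_def s)
qed

lemma variation_field_tangent:
  assumes "s \<in> S" shows "variation_field s \<in> tangent_space A (f s)"
proof -
  obtain t w where s: "s = (t, w)" by force
  have tw: "t \<in> {t0..tf}" "w \<in> {0<..<1}"
    using assms by (auto simp: S_def s)
  have "velocity A {0<..<1} (\<lambda>w. f (t, w)) w \<in> tangent_space A (f (t, w))"
  proof (rule velocity_in_tangent_space[OF manifold])
    show "continuous_on {0<..<1} (\<lambda>w. f (t, w))"
      using tw by (intro continuous_on_compose2[OF continuous_on_f] continuous_intros) (auto simp: S_def)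
    show "(\<lambda>w. f (t, w)) ` {0<..<1} \<subseteq> M"
      using f_into tw by (auto simp: S_def)
    show "(snd \<phi> \<circ> (\<lambda>w. f (t, w))) differentiable (at w within {0<..<1})"
      if "\<phi> \<in> charts_at A (f (t, w))" for \<phi>
      using that y_has_variation_derivative[of \<phi> t w] assms
      by (auto simp: charts_at_f s y_def comp_def has_vector_derivative_def differentiable_def)
  qed (use tw weight_interval_nontrivial in auto)
  then show ?thesis
    by (simp add: variation_field_def s)
qed

text \<open>The product rule in direction \<open>h\<close> for the coordinate expression of an inner
  product of two first derivatives; the middle summand is due to the Gram matrix varying along the
  family.\<close>

definition d_inner ::
  "real \<times> real \<Rightarrow> real \<times> real \<Rightarrow> ('a, 'n) chart \<Rightarrow> real \<times> real \<Rightarrow> real \<times> real \<Rightarrow> real" where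
  "d_inner a b \<phi> s h =
     dy a \<phi> s \<bullet> (g \<phi> (y \<phi> s) *v ddy b \<phi> s h +
       frechet_derivative (g \<phi>) (at (y \<phi> s)) (dy h \<phi> s) *v dy b \<phi> s) +
     ddy a \<phi> s h \<bullet> (g \<phi> (y \<phi> s) *v dy b \<phi> s)"

lemma has_derivative_inner_at:
  assumes X: "\<And>s. s \<in> S \<Longrightarrow> X s \<in> tangent_space A (f s)"
      "\<And>\<phi> s. \<phi> \<in> A \<Longrightarrow> s \<in> W \<phi> \<Longrightarrow> X s \<phi> = dy a \<phi> s"
    and Y: "\<And>s. s \<in> S \<Longrightarrow> Y s \<in> tangent_space A (f s)"
      "\<And>\<phi> s. \<phi> \<in> A \<Longrightarrow> s \<in> W \<phi> \<Longrightarrow> Y s \<phi> = dy b \<phi> s"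
    and \<phi>: "\<phi> \<in> A" "s \<in> W \<phi>"
  shows "((\<lambda>s. inner_at A g (f s) (X s) (Y s)) has_derivative d_inner a b \<phi> s) (at s within S)"
proof -
  have chart: "inner_at A g (f s) (X s) (Y s) = dy a \<phi> s \<bullet> (g \<phi> (y \<phi> s) *v dy b \<phi> s)"
    if "s \<in> W \<phi>" for s
  proof -
    have s: "s \<in> S" "\<phi> \<in> charts_at A (f s)"
      using that \<phi> by (auto simp: W_def charts_at_def)
    show ?thesis
      using inner_at_eq_chart[OF metric X(1)[OF s(1)] Y(1)[OF s(1)] s(2)] X(2) Y(2) \<phi>(1) that
      by (simp add: y_def)
  qed
  have "(g \<phi> has_derivative frechet_derivative (g \<phi>) (at (y \<phi> s))) (at (y \<phi> s))"
    using \<phi> by (intro Gram_matrix_has_derivative[OF manifold metric]) (auto simp: W_def y_def)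
  then have "((\<lambda>s. g \<phi> (y \<phi> s)) has_derivative
      (\<lambda>h. frechet_derivative (g \<phi>) (at (y \<phi> s)) (dy h \<phi> s))) (at s within S)"
    by (rule has_derivative_compose[OF has_derivative_y[OF \<phi>]])
  then have "((\<lambda>s. dy a \<phi> s \<bullet> (g \<phi> (y \<phi> s) *v dy b \<phi> s)) has_derivative d_inner a b \<phi> s)
      (at s within S)"
    unfolding d_inner_def
    by (intro bounded_bilinear.FDERIV[OF bounded_bilinear_inner]
        bounded_bilinear.FDERIV[OF bounded_bilinear_matrix_vector_mult] has_derivative_dy \<phi>)
  \<comment> \<open>The chart formula for \<open>inner_at\<close> is available on
    \<open>W \<phi>\<close> only, so the function is exchanged within that set before returning to
    \<open>S\<close>.\<close>
  then have "((\<lambda>s. dy a \<phi> s \<bullet> (g \<phi> (y \<phi> s) *v dy b \<phi> s)) has_derivative d_inner a b \<phi> s)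
      (at s within W \<phi>)"
    by (simp add: at_W[OF \<phi>])
  then have "((\<lambda>s. inner_at A g (f s) (X s) (Y s)) has_derivative d_inner a b \<phi> s) (at s within W \<phi>)"
    by (rule has_derivative_transform[rotated -1]) (use \<phi> chart in auto)
  then show ?thesis
    by (simp add: at_W[OF \<phi>])
qed

lemma continuous_on_d_inner:
  assumes "\<phi> \<in> A"
  shows "continuous_on (W \<phi>) (\<lambda>s. d_inner a b \<phi> s h)"
proof -
  note mult = bounded_bilinear.continuous_on[OF bounded_bilinear_matrix_vector_mult]
  have g: "smooth_on (snd \<phi> ` fst \<phi>) (g \<phi>)" "open (snd \<phi> ` fst \<phi>)" "y \<phi> ` W \<phi> \<subseteq> snd \<phi> ` fst \<phi>"
    using assms metric manifold unfolding riemannian_metric_def smooth_manifold_def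
    by (blast, blast) (auto simp: y_def W_def)
  have "continuous_on (W \<phi>) (\<lambda>s. g \<phi> (y \<phi> s))"
    using smooth_on_imp_continuous_on[OF g(1)] continuous_on_y[OF assms] g(3)
    by (rule continuous_on_compose2)
  moreover have "continuous_on (W \<phi>) (\<lambda>s. frechet_derivative (g \<phi>) (at (y \<phi> s)) (dy h \<phi> s))"
    using g continuous_on_y[OF assms] continuous_on_dy[OF assms]
    by (intro continuous_on_frechet_derivative_compose[of "snd \<phi> ` fst \<phi>"])
  ultimately show ?thesis
    unfolding d_inner_def
    by (intro continuous_on_add continuous_on_inner mult continuous_on_dy continuous_on_ddy assms)
qed

text \<open>
  The endpoints of the time interval are excluded, since symmetry of second derivatives is only
  available on open sets; they do not matter under the integral.
\<close>

lemma ddy_commute: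
  assumes \<phi>: "\<phi> \<in> A" "(t, w) \<in> W \<phi>" and t: "t \<in> {t0<..<tf}"
  shows "ddy (1, 0) \<phi> (t, w) (0, 1) = ddy (0, 1) \<phi> (t, w) (1, 0)"
proof -
  \<comment> \<open>\<open>W \<phi>\<close> is open only relative to the strip; removing the two
    time boundaries gives a set that is open in the plane.\<close>
  define Q where "Q = W \<phi> \<inter> ({t0<..<tf} \<times> {0<..<1})"
  have oS: "open ({t0<..<tf} \<times> {0<..<(1::real)})"
    by (intro open_Times) auto
  obtain T where T: "open T" "W \<phi> = S \<inter> T"
    using openin_W[OF \<phi>(1)] by (auto simp: openin_open)
  have "Q = T \<inter> ({t0<..<tf} \<times> {0<..<1})"
    using T by (auto simp: Q_def S_def)
  then have Q: "open Q" "(t, w) \<in> Q"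
    using T oS \<phi>(2) t by (auto simp: Q_def S_def)
  have sub: "Q \<subseteq> W \<phi>"
    by (auto simp: Q_def)
  have 1: "((\<lambda>t. h (t, b)) has_vector_derivative D (1, 0)) (at a)"
    if "(h has_derivative D) (at (a, b) within S)" "(a, b) \<in> Q"
    for h :: "real \<times> real \<Rightarrow> real ^ 'n" and D a b
    using has_vector_derivative_fst[of h D a b "{t0..tf}" "{0<..<1}"] that
    by (auto simp: Q_def S_def at_within_Icc_at)
  have 2: "((\<lambda>w. h (a, w)) has_vector_derivative D (0, 1)) (at b)"
    if "(h has_derivative D) (at (a, b) within S)" "(a, b) \<in> Q"
    for h :: "real \<times> real \<Rightarrow> real ^ 'n" and D a b
    using has_vector_derivative_snd[of h D a b "{t0..tf}" "{0<..<1}"] that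
    by (auto simp: Q_def S_def at_weight)
  show ?thesis
  proof (rule mixed_partial_derivatives_commute[OF Q, of "y \<phi>" "dy (1, 0) \<phi>" "dy (0, 1) \<phi>"
      "\<lambda>s. ddy (1, 0) \<phi> s (0, 1)" "\<lambda>s. ddy (0, 1) \<phi> s (1, 0)"])
    show "continuous_on Q (\<lambda>s. ddy (1, 0) \<phi> s (0, 1))"
      using continuous_on_ddy[OF \<phi>(1)] sub by (rule continuous_on_subset)
    show "((\<lambda>t. y \<phi> (t, w)) has_vector_derivative dy (1, 0) \<phi> (t, w)) (at t)"
      if "(t, w) \<in> Q" for t w
      using 1[OF has_derivative_y] that sub \<phi>(1) by blast
    show "((\<lambda>w. y \<phi> (t, w)) has_vector_derivative dy (0, 1) \<phi> (t, w)) (at w)"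
      if "(t, w) \<in> Q" for t w
      using 2[OF has_derivative_y] that sub \<phi>(1) by blast
    show "((\<lambda>w. dy (1, 0) \<phi> (t, w)) has_vector_derivative ddy (1, 0) \<phi> (t, w) (0, 1)) (at w)"
      if "(t, w) \<in> Q" for t w
      using 2[OF has_derivative_dy] that sub \<phi>(1) by blast
    show "((\<lambda>t. dy (0, 1) \<phi> (t, w)) has_vector_derivative ddy (0, 1) \<phi> (t, w) (1, 0)) (at t)"
      using 1[OF has_derivative_dy] Q(2) sub \<phi>(1) by blast
  qed
qed

section \<open>Acceleration paired with the variation field\<close>

lemma acceleration_chart:
  assumes \<phi>: "\<phi> \<in> A" "(t, w) \<in> W \<phi>"
  shows "acceleration A g {t0..tf} (\<lambda>t. f (t, w)) t \<phi> =
    ddy (1, 0) \<phi> (t, w) (1, 0) +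
    christoffel (g \<phi>) (y \<phi> (t, w)) (dy (1, 0) \<phi> (t, w)) (dy (1, 0) \<phi> (t, w))"
proof -
  have tw: "t \<in> {t0..tf}" "w \<in> {0<..<1}" "\<phi> \<in> charts_at A (f (t, w))"
    using \<phi> by (auto simp: W_def S_def charts_at_def)
  \<comment> \<open>The velocity entry for \<open>\<phi>\<close> agrees with \<open>dy\<close> only
    at times when the curve lies in this chart and is normalised to 0 at all others;
    \<open>I\<close> is the relatively open set of the former.\<close>
  define I where "I = {t \<in> {t0..tf}. (t, w) \<in> W \<phi>}"
  have oI: "openin (top_of_set {t0..tf}) I" "t \<in> I"
  proof -
    obtain T where T: "open T" "W \<phi> = S \<inter> T"
      using openin_W[OF \<phi>(1)] by (auto simp: openin_open)
    have "I = {t0..tf} \<inter> (\<lambda>t. (t, w)) -` T"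
      using tw by (auto simp: I_def T S_def)
    moreover have "open ((\<lambda>t. (t, w)) -` T)"
      using T(1) by (intro open_vimage continuous_intros)
    ultimately show "openin (top_of_set {t0..tf}) I"
      by (auto simp: openin_open)
    show "t \<in> I"
      using tw \<phi> by (simp add: I_def)
  qed
  have vel: "velocity A {t0..tf} (\<lambda>t. f (t, w)) r \<phi> = dy (1, 0) \<phi> (r, w)" if "r \<in> I" for r
    using time_velocity_chart[OF \<phi>(1), of "(r, w)"] that by (simp add: I_def time_velocity_def)
  have "((\<lambda>t. dy (1, 0) \<phi> (t, w)) has_vector_derivative ddy (1, 0) \<phi> (t, w) (1, 0))
      (at t within {t0..tf})"
    using has_derivative_dy[OF \<phi>] tw unfolding S_def by (intro has_vector_derivative_fst)
  then have "((\<lambda>t. dy (1, 0) \<phi> (t, w)) has_vector_derivative ddy (1, 0) \<phi> (t, w) (1, 0)) (at t within I)"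
    by (simp add: at_within_openin[OF oI])
  then have "((\<lambda>r. velocity A {t0..tf} (\<lambda>t. f (t, w)) r \<phi>) has_vector_derivative
      ddy (1, 0) \<phi> (t, w) (1, 0)) (at t within I)"
    by (rule has_vector_derivative_transform[rotated -1]) (use oI vel in auto)
  then have "((\<lambda>r. velocity A {t0..tf} (\<lambda>t. f (t, w)) r \<phi>) has_vector_derivative
      ddy (1, 0) \<phi> (t, w) (1, 0)) (at t within {t0..tf})"
    by (simp add: at_within_openin[OF oI])
  from vector_derivative_within[OF time_interval_nontrivial[OF tw(1)] this] show ?thesis
    using tw vel oI by (simp add: acceleration_def covariant_deriv_def y_def)
qed

text \<open>
  This is the chart in which \<open>inner_at\<close> evaluates at \<open>f s\<close>. Computing there avoids the
  transformation law of the acceleration under a change of charts.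
\<close>

definition chart_of :: "real \<times> real \<Rightarrow> ('a, 'n) chart" where
  "chart_of s = (SOME \<phi>. \<phi> \<in> charts_at A (f s))"

lemma chart_of:
  assumes "s \<in> S" shows "chart_of s \<in> A" "s \<in> W (chart_of s)"
  using someI_ex[OF chart_at_f_exists[OF assms]] assms by (auto simp: chart_of_def charts_at_f)

text \<open>This is <\<open>\<nabla>\<^sub>t v\<close>, x'> = d/dt <v, x'> - 1/2 d/dw <v, v> in
  coordinates. The Christoffel term of the acceleration accounts for the derivatives of the Gram
  matrix on the right.\<close>

lemma inner_acceleration_variation:
  assumes t: "t \<in> {t0<..<tf}" and w: "w \<in> {0<..<1}"
  shows "inner_at A g (f (t, w)) (acceleration A g {t0..tf} (\<lambda>t. f (t, w)) t) (variation_field (t, w)) =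
    d_inner (1, 0) (0, 1) (chart_of (t, w)) (t, w) (1, 0)
      - d_inner (1, 0) (1, 0) (chart_of (t, w)) (t, w) (0, 1) / 2"
proof -
  let ?s = "(t, w)"
  define \<phi> where "\<phi> = chart_of ?s"
  have s: "?s \<in> S"
    using t w by (auto simp: S_def)
  have \<phi>: "\<phi> \<in> A" "?s \<in> W \<phi>"
    using chart_of[OF s] by (auto simp: \<phi>_def)
  define G where "G = g \<phi> (y \<phi> ?s)"
  define D where "D = frechet_derivative (g \<phi>) (at (y \<phi> ?s))"
  define u v where "u = dy (1, 0) \<phi> ?s" and "v = dy (0, 1) \<phi> ?s"
  have ys: "y \<phi> ?s \<in> snd \<phi> ` fst \<phi>"
    using \<phi> by (auto simp: W_def y_def)
  have op: "open (snd \<phi> ` fst \<phi>)"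
    using manifold \<phi> unfolding smooth_manifold_def by blast
  have sym: "transpose (g \<phi> z) = g \<phi> z" if "z \<in> snd \<phi> ` fst \<phi>" for z
    using metric \<phi>(1) that unfolding riemannian_metric_def by blast
  have symG: "a \<bullet> (G *v b) = b \<bullet> (G *v a)" for a b
    using sym[OF ys] by (metis G_def dot_lmul_matrix inner_commute transpose_matrix_vector)
  have pos: "0 < a \<bullet> (g \<phi> (y \<phi> ?s) *v a)" if "a \<noteq> 0" for a
    using metric \<phi>(1) ys that unfolding riemannian_metric_def by blast
  have dif: "g \<phi> differentiable at (y \<phi> ?s)"
    using Gram_matrix_has_derivative[OF manifold metric \<phi>(1) ys] differentiable_def by blast
  have chr: "christoffel (g \<phi>) (y \<phi> ?s) u u \<bullet> (G *v v) = u \<bullet> (D u *v v) - u \<bullet> (D v *v u) / 2"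
    unfolding G_def D_def
    by (rule inner_christoffel[OF op ys sym dif invertible_pos_def[OF pos]])
  have "inner_at A g (f ?s) (acceleration A g {t0..tf} (\<lambda>t. f (t, w)) t) (variation_field ?s) =
      acceleration A g {t0..tf} (\<lambda>t. f (t, w)) t \<phi> \<bullet> (G *v v)"
    using variation_field_chart[OF \<phi>]
    by (simp add: inner_at_def Let_def \<phi>_def chart_of_def G_def v_def y_def)
  also have "\<dots> = ddy (1, 0) \<phi> ?s (1, 0) \<bullet> (G *v v) + u \<bullet> (D u *v v) - u \<bullet> (D v *v u) / 2"
    using chr by (simp add: acceleration_chart[OF \<phi>] inner_add_left u_def)
  \<comment> \<open>The time derivative of x' contributes one mixed second derivative. Half of the
    weight derivative of <v, v> contributes two halves of it, equal by symmetry of the Gram matrix,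
    so they cancel.\<close>
  also have "\<dots> = d_inner (1, 0) (0, 1) \<phi> ?s (1, 0) - d_inner (1, 0) (1, 0) \<phi> ?s (0, 1) / 2"
    using ddy_commute[OF \<phi> t] symG[of "ddy (1, 0) \<phi> ?s (0, 1)" u]
    by (simp add: d_inner_def inner_add_right field_simps flip: G_def D_def u_def v_def)
  finally show ?thesis
    by (simp add: \<phi>_def)
qed

section \<open>Differentiating the energy under the integral sign\<close>

definition speed2 :: "real \<times> real \<Rightarrow> real" where
  "speed2 s = inner_at A g (f s) (time_velocity s) (time_velocity s)"

definition d_speed2 :: "real \<times> real \<Rightarrow> real" where
  "d_speed2 s = d_inner (1, 0) (1, 0) (chart_of s) s (0, 1)"

lemma has_derivative_speed2:
  assumes "\<phi> \<in> A" "s \<in> W \<phi>"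
  shows "(speed2 has_derivative d_inner (1, 0) (1, 0) \<phi> s) (at s within S)"
  using has_derivative_inner_at[of time_velocity "(1, 0)" time_velocity "(1, 0)" \<phi> s]
    time_velocity_tangent time_velocity_chart assms
  unfolding speed2_def by blast

lemma has_derivative_mixed:
  assumes "\<phi> \<in> A" "s \<in> W \<phi>"
  shows "((\<lambda>s. inner_at A g (f s) (time_velocity s) (variation_field s)) has_derivative
    d_inner (1, 0) (0, 1) \<phi> s) (at s within S)"
  using has_derivative_inner_at[of time_velocity "(1, 0)" variation_field "(0, 1)" \<phi> s]
    time_velocity_tangent time_velocity_chart variation_field_tangent variation_field_chart assms
  by blast

lemma continuous_on_speed2: "continuous_on S speed2"
  unfolding continuous_on_eq_continuous_within
  using has_derivative_continuous[OF has_derivative_speed2] chart_of by blast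

lemma speed2_has_variation_derivative:
  assumes "\<phi> \<in> A" "(t, w) \<in> W \<phi>"
  shows "((\<lambda>w. speed2 (t, w)) has_vector_derivative d_inner (1, 0) (1, 0) \<phi> (t, w) (0, 1)) (at w)"
proof -
  have "t \<in> {t0..tf}" "w \<in> {0<..<1}"
    using assms by (auto simp: W_def S_def)
  then show ?thesis
    using has_vector_derivative_snd[of speed2 "d_inner (1, 0) (1, 0) \<phi> (t, w)" t w
        "{t0..tf}" "{0<..<1}"]
      has_derivative_speed2[OF assms] by (simp add: S_def at_weight)
qed

text \<open>The expressions in two charts are derivatives in w of the same function
  \<open>speed2\<close>, so uniqueness of the derivative identifies them, without transforming
  second derivatives between charts.\<close>

lemma d_speed2_chart:
  assumes "\<phi> \<in> A" "s \<in> W \<phi>"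
  shows "d_speed2 s = d_inner (1, 0) (1, 0) \<phi> s (0, 1)"
proof -
  obtain t w where s: "s = (t, w)" by force
  have "s \<in> S"
    using assms by (simp add: W_def)
  then show ?thesis
    using vector_derivative_unique_at[OF speed2_has_variation_derivative speed2_has_variation_derivative,
        of "chart_of s" t w \<phi>] assms chart_of[of s]
    by (simp add: d_speed2_def s)
qed

lemma continuous_on_d_speed2: "continuous_on S d_speed2"
  unfolding continuous_on_eq_continuous_within
proof
  fix s assume s: "s \<in> S"
  let ?\<phi> = "chart_of s"
  \<comment> \<open>Freezing the chart selected at \<open>s\<close> gives continuity around
    \<open>s\<close>, although \<open>chart_of\<close> itself may be discontinuous.\<close>
  have "continuous_on (W ?\<phi>) d_speed2"
    by (rule continuous_on_eq[OF continuous_on_d_inner[OF chart_of(1)[OF s]]])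
       (rule d_speed2_chart[OF chart_of(1)[OF s], symmetric])
  then have "continuous (at s within W ?\<phi>) d_speed2"
    using chart_of(2)[OF s] by (simp add: continuous_on_eq_continuous_within)
  then show "continuous (at s within S) d_speed2"
    using at_W chart_of s by simp
qed

lemma F1_eq: "F1 A g t0 tf (\<lambda>t. f (t, w)) = integral {t0..tf} (\<lambda>t. speed2 (t, w))"
  by (simp add: F1_def speed2_def time_velocity_def)

lemma F1_has_derivative:
  assumes w: "w \<in> {0<..<1}"
  shows "((\<lambda>w. F1 A g t0 tf (\<lambda>t. f (t, w))) has_real_derivative
    integral {t0..tf} (\<lambda>t. d_speed2 (t, w))) (at w)"
proof -
  have "((\<lambda>w. integral (cbox t0 tf) (\<lambda>t. speed2 (t, w))) has_vector_derivative
    integral (cbox t0 tf) (\<lambda>t. d_speed2 (t, w))) (at w within {0<..<1})"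
  proof (rule leibniz_rule_vector_derivative)
    show "((\<lambda>w. speed2 (t, w)) has_vector_derivative d_speed2 (t, w)) (at w within {0<..<1})"
      if "w \<in> {0<..<1}" "t \<in> cbox t0 tf" for w t
      using that speed2_has_variation_derivative[OF chart_of, of t w]
      by (simp add: S_def d_speed2_def at_weight)
    show "(\<lambda>t. speed2 (t, w)) integrable_on cbox t0 tf" if "w \<in> {0<..<1}" for w
      unfolding cbox_interval using that
      by (intro integrable_continuous_real continuous_on_compose2[OF continuous_on_speed2]
          continuous_intros) (auto simp: S_def)
    show "continuous_on ({0<..<1} \<times> cbox t0 tf) (\<lambda>(w, t). d_speed2 (t, w))"
      unfolding split_beta
      by (intro continuous_on_compose2[OF continuous_on_d_speed2] continuous_intros) (auto simp: S_def)
  qed (use w in auto)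
  then show ?thesis
    using w by (simp add: F1_eq at_weight has_real_derivative_iff_has_vector_derivative)
qed

text \<open>This removes the boundary terms at fixed endpoints. A constant curve has derivative 0
  under every coordinate map, whether or not \<open>p\<close> lies in its domain, so all entries
  vanish.\<close>

lemma variation_field_eq_0:
  assumes "w \<in> {0<..<1}" "\<And>w. w \<in> {0<..<1} \<Longrightarrow> f (t, w) = p"
  shows "variation_field (t, w) = (\<lambda>_. 0)"
proof -
  have "vector_derivative (snd \<phi> \<circ> (\<lambda>w. f (t, w))) (at w within {0<..<1}) = 0" for \<phi> :: "('a, 'n) chart"
  proof (rule vector_derivative_within[OF weight_interval_nontrivial[OF assms(1)]])
    have "((\<lambda>w. snd \<phi> p) has_vector_derivative 0) (at w within {0<..<1})"
      by simp
    then show "((snd \<phi> \<circ> (\<lambda>w. f (t, w))) has_vector_derivative 0) (at w within {0<..<1})"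
      by (rule has_vector_derivative_transform[rotated -1]) (use assms in auto)
  qed
  then show ?thesis
    by (auto simp: variation_field_def velocity_def)
qed

theorem first_variation_F1:
  assumes w: "w \<in> {0<..<1}"
    and ends: "\<And>w. w \<in> {0<..<1} \<Longrightarrow> f (t0, w) = p" "\<And>w. w \<in> {0<..<1} \<Longrightarrow> f (tf, w) = q"
  shows "((\<lambda>w. F1 A g t0 tf (\<lambda>t. f (t, w))) has_real_derivative
    - 2 * integral {t0..tf} (\<lambda>t. inner_at A g (f (t, w))
        (acceleration A g {t0..tf} (\<lambda>t. f (t, w)) t)
        (velocity A {0<..<1} (\<lambda>w. f (t, w)) w))) (at w)"
proof -
  define P where "P = (\<lambda>s. inner_at A g (f s) (time_velocity s) (variation_field s))"
  define P' where "P' = (\<lambda>t. d_inner (1, 0) (0, 1) (chart_of (t, w)) (t, w) (1, 0))"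
  \<comment> \<open>Integrating the time derivative of <v, x'> leaves its endpoint values;
    derivatives in the open interval and continuity up to the ends are enough for this.\<close>
  have "(P' has_integral (P (tf, w) - P (t0, w))) {t0..tf}"
  proof (rule fundamental_theorem_of_calculus_interior)
    have "continuous_on S P"
      unfolding continuous_on_eq_continuous_within P_def
      using has_derivative_continuous[OF has_derivative_mixed] chart_of by blast
    then show "continuous_on {t0..tf} (\<lambda>t. P (t, w))"
      by (rule continuous_on_compose2) (use w in \<open>auto intro!: continuous_intros simp: S_def\<close>)
    show "((\<lambda>t. P (t, w)) has_vector_derivative P' t) (at t)" if "t \<in> {t0<..<tf}" for t
    proof -
      have s: "(t, w) \<in> S"
        using that w by (auto simp: S_def)
      show ?thesis
        using has_vector_derivative_fst[of P "d_inner (1, 0) (0, 1) (chart_of (t, w)) (t, w)" t w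
            "{t0..tf}" "{0<..<1}"]
          has_derivative_mixed[OF chart_of[OF s]] that w
        by (simp add: P_def P'_def S_def at_within_Icc_at)
    qed
  qed (use interval in simp)
  moreover have "P (t0, w) = 0" "P (tf, w) = 0"
    using variation_field_eq_0[OF w ends(1)] variation_field_eq_0[OF w ends(2)]
    by (simp_all add: P_def inner_at_def)
  ultimately have "(P' has_integral 0) {t0..tf}"
    by simp
  moreover have "((\<lambda>t. d_speed2 (t, w)) has_integral integral {t0..tf} (\<lambda>t. d_speed2 (t, w))) {t0..tf}"
    using w by (intro integrable_integral integrable_continuous_real
        continuous_on_compose2[OF continuous_on_d_speed2] continuous_intros) (auto simp: S_def)
  ultimately have "((\<lambda>t. P' t - d_speed2 (t, w) / 2) has_integral
      (0 - integral {t0..tf} (\<lambda>t. d_speed2 (t, w)) / 2)) {t0..tf}"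
    by (intro has_integral_diff has_integral_divide)
  \<comment> \<open>The pointwise identity is proved for interior times, and the two endpoints form
    a finite set that does not affect the integral.\<close>
  then have "((\<lambda>t. inner_at A g (f (t, w)) (acceleration A g {t0..tf} (\<lambda>t. f (t, w)) t)
      (variation_field (t, w))) has_integral
      (0 - integral {t0..tf} (\<lambda>t. d_speed2 (t, w)) / 2)) {t0..tf}"
    by (rule has_integral_spike_finite[of "{t0, tf}", rotated 2])
       (use w inner_acceleration_variation in \<open>auto simp: P'_def d_speed2_def\<close>)
  then have "- 2 * integral {t0..tf} (\<lambda>t. inner_at A g (f (t, w))
        (acceleration A g {t0..tf} (\<lambda>t. f (t, w)) t) (variation_field (t, w))) =
      integral {t0..tf} (\<lambda>t. d_speed2 (t, w))"
    by (simp add: integral_unique)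
  then show ?thesis
    using F1_has_derivative[OF w] by (simp add: variation_field_def)
qed

end

section \<open>Weighted-sum optimality\<close>

text \<open>The intermediate point lies on the front, so it has a weight of its own. Its optimality
  is compared with each of the two outer points, and the domain of \<open>PF\<close> may have
  gaps.\<close>

lemma convex_front_weighted_sum:
  assumes PF: "\<And>w. w \<in> {0<..<1} \<Longrightarrow> G w = PF (F w)"
    and opt: "\<And>w w'. w \<in> {0<..<1} \<Longrightarrow> w' \<in> {0<..<1} \<Longrightarrow>
      w * F w + (1 - w) * G w \<le> w * F w' + (1 - w) * G w'"
  shows "convex_front (F ` {0<..<1}) PF"
  unfolding convex_front_def
proof (intro ballI impI)
  fix a b s
  assume ab: "a \<in> F ` {0<..<1}" "b \<in> F ` {0<..<1}" and s: "s \<in> {0..1::real}"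
    and m: "s * a + (1 - s) * b \<in> F ` {0<..<1}"
  define m where "m = s * a + (1 - s) * b"
  obtain w where w: "w \<in> {0<..<1}" "m = F w"
    using m by (auto simp: m_def)
  have supp: "w * m + (1 - w) * PF m \<le> w * c + (1 - w) * PF c" if "c \<in> F ` {0<..<1}" for c
    using that opt[OF w(1)] PF w by auto
  have "s * (w * m + (1 - w) * PF m) + (1 - s) * (w * m + (1 - w) * PF m) \<le>
      s * (w * a + (1 - w) * PF a) + (1 - s) * (w * b + (1 - w) * PF b)"
    using s by (intro add_mono mult_left_mono[OF supp[OF ab(1)]] mult_left_mono[OF supp[OF ab(2)]]) auto
  \<comment> \<open>Averaging with weights \<open>s\<close> and \<open>1 - s\<close> reproduces
    \<open>w * m\<close> on the right, which cancels and leaves the positive factor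
    \<open>1 - w\<close>.\<close>
  also have "\<dots> = w * m + (1 - w) * (s * PF a + (1 - s) * PF b)"
    by (simp add: m_def algebra_simps)
  finally have "(1 - w) * PF m \<le> (1 - w) * (s * PF a + (1 - s) * PF b)"
    by (simp add: algebra_simps)
  then show "PF (s * a + (1 - s) * b) \<le> s * PF a + (1 - s) * PF b"
    using w(1) by (simp add: m_def)
qed

lemma weighted_sum_antitone:
  fixes F G :: "real \<Rightarrow> real"
  assumes w: "w \<in> {0<..<1}" "w' \<in> {0<..<1}" "w < w'"
    and opt: "w * F w + (1 - w) * G w \<le> w * F w' + (1 - w) * G w'"
      "w' * F w' + (1 - w') * G w' \<le> w' * F w + (1 - w') * G w"
  shows "F w' \<le> F w"
proof -
  \<comment> \<open>The multipliers \<open>1 - w'\<close> and \<open>1 - w\<close> give all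
    \<open>G\<close> terms the same coefficient, so they cancel; the \<open>F\<close> terms are left
    with coefficient \<open>w' - w\<close>.\<close>
  have "(1 - w') * (w * F w + (1 - w) * G w) + (1 - w) * (w' * F w' + (1 - w') * G w') \<le>
      (1 - w') * (w * F w' + (1 - w) * G w') + (1 - w) * (w' * F w + (1 - w') * G w)"
    using w by (intro add_mono mult_left_mono[OF opt(1)] mult_left_mono[OF opt(2)]) auto
  then have "(w' - w) * F w' \<le> (w' - w) * F w"
    by (simp add: algebra_simps)
  then show ?thesis
    using w by simp
qed

theorem theorem3:
  fixes M :: "'a::{t2_space, second_countable_topology} set"
    and A :: "('a, 'n::finite) chart set"
    and g :: "('a, 'n) metric"
    and t0 tf :: real
    and x0 x1 :: 'a
    and v0 v1 :: "('a, 'n) tangent"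
    and x :: "real \<Rightarrow> real \<Rightarrow> 'a"
    and PF :: "real \<Rightarrow> real"
  assumes manifold: "smooth_manifold M A" "path_connected M"
    and metric: "riemannian_metric A g"
    and interval: "t0 < tf"
    and boundary: "x0 \<in> M" "x1 \<in> M" "v0 \<in> tangent_space A x0" "v1 \<in> tangent_space A x1"
    and optimal: "\<And>w. w \<in> {0<..<1} \<Longrightarrow>
        is_arg_min (\<lambda>c. w * F1 A g t0 tf c + (1 - w) * F2 A g t0 tf c)
          (\<lambda>c. c \<in> admissible_curves M A t0 tf x0 v0 x1 v1) (\<lambda>t. x t w)"
    and smooth: "smooth_map_into M A ({t0..tf} \<times> {0<..<1}) (\<lambda>(t, w). x t w)"
    and EL: "\<And>w. w \<in> {0<..<1} \<Longrightarrow> euler_lagrange A g {t0..tf} (w / (1 - w)) (\<lambda>t. x t w)"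
    and front: "\<And>w. w \<in> {0<..<1} \<Longrightarrow>
        F2 A g t0 tf (\<lambda>t. x t w) = PF (F1 A g t0 tf (\<lambda>t. x t w))"
  shows "convex_front ((\<lambda>w. F1 A g t0 tf (\<lambda>t. x t w)) ` {0<..<1}) PF \<longleftrightarrow>
    (\<forall>w\<in>{0<..<1}.
       0 \<le> integral {t0..tf} (\<lambda>t. inner_at A g (x t w)
             (acceleration A g {t0..tf} (\<lambda>t. x t w) t)
             (velocity A {0<..<1} (\<lambda>w. x t w) w)))"
proof -
  interpret variation M A g t0 tf "\<lambda>(t, w). x t w"
    using manifold(1) metric interval smooth by unfold_locales
  define F where "F = (\<lambda>w. F1 A g t0 tf (\<lambda>t. x t w))"
  define G where "G = (\<lambda>w. F2 A g t0 tf (\<lambda>t. x t w))"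
  have adm: "(\<lambda>t. x t w) \<in> admissible_curves M A t0 tf x0 v0 x1 v1" if "w \<in> {0<..<1}" for w
    using optimal[OF that] by (simp add: is_arg_min_def)
  have opt: "w * F w + (1 - w) * G w \<le> w * F w' + (1 - w) * G w'"
    if "w \<in> {0<..<1}" "w' \<in> {0<..<1}" for w w'
    using optimal[OF that(1)] adm[OF that(2)] by (force simp: is_arg_min_def F_def G_def)
  have "convex_front (F ` {0<..<1}) PF"
    using front opt by (intro convex_front_weighted_sum[of G PF F]) (auto simp: F_def G_def)
  moreover have "0 \<le> integral {t0..tf} (\<lambda>t. inner_at A g (x t w)
             (acceleration A g {t0..tf} (\<lambda>t. x t w) t)
             (velocity A {0<..<1} (\<lambda>w. x t w) w))" (is "0 \<le> ?I") if w: "w \<in> {0<..<1}" for w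
  \<comment> \<open>A negative integral would make the derivative of \<open>F\<close> positive,
    hence \<open>F\<close> larger just to the right of \<open>w\<close>, against its
    monotonicity.\<close>
  proof (rule ccontr)
    assume "\<not> 0 \<le> ?I"
    moreover have "(F has_real_derivative - 2 * ?I) (at w)"
      using first_variation_F1[OF w, of x0 x1] adm
      by (simp add: F_def admissible_curves_def)
    ultimately obtain d where d: "d > 0" "\<And>h. 0 < h \<Longrightarrow> h < d \<Longrightarrow> F w < F (w + h)"
      using DERIV_pos_inc_right[of F "- 2 * ?I" w] by auto
    \<comment> \<open>Halving the minimum makes both bounds strict: \<open>h < d\<close>, and
      \<open>w + h\<close> is still an admissible weight.\<close>
    define h where "h = min d (1 - w) / 2"
    have "0 < h" "h \<le> d / 2" "h \<le> (1 - w) / 2"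
      using d(1) w by (auto simp: h_def)
    then have h: "0 < h" "h < d" "w + h \<in> {0<..<1}"
      using d(1) w by auto
    then have "F (w + h) \<le> F w"
      using w by (intro weighted_sum_antitone[of w "w + h" F G] opt) auto
    then show False
      using d(2)[OF h(1,2)] by simp
  qed
  ultimately show ?thesis
    by (simp add: F_def)
qed

end
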